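(* Given $m\ge \max_{1\le i\le s,\,1\le j\le t}\{n_{ij}+d+2\}$ distinct nodes $\mathcal X=\{x_\ell\}_{\ell=1}^m$ in $\mathbb C$, let $$\eta_2:=\inf\Big\{\eta\in\mathbb R:\ \exists\, p_{ij}\in\mathbb P_{n_{ij}}\ (1\le i\le s,1\le j\le t),\ 0\not\equiv q\in\mathbb P_d \text{ with } \sum_{i=1}^s\sum_{j=1}^t|f_{ij}(x_\ell)q(x_\ell)-p_{ij}(x_\ell)|^2\le \eta\,|q(x_\ell)|^2,\ 1\le \ell\le m\Big\}.$$ Then $\eta_2$ is attained by certain polynomials $p_{ij}\in\mathbb P_{n_{ij}}$ $(1\le i\le s,1\le j\le t)$ and $0\not\equiv q\in\mathbb P_d$; that is, there exist such polynomials for which $(\eta_2,\{p_{ij}\},q)$ satisfies all $m$ constraints.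
   Context: Here $s,t\ge1$ and $d,n_{ij}\ge 0$ are given integers, $\mathbb P_n$ is the set of complex polynomials of degree at most $n$, and $F(x_\ell)=[f_{ij}(x_\ell)]\in\mathbb C^{s\times t}$, $1\le\ell\le m$, are given matrix data at the nodes. *)

theory Defs
  imports "HOL-Analysis.Analysis" "HOL-Computational_Algebra.Polynomial"
begin

text \<open>As \<open>degree 0 = 0\<close>, the zero polynomial belongs to every \<open>polys_upto n\<close>.\<close>

definition polys_upto :: "nat \<Rightarrow> complex poly set" where
  "polys_upto n = {p. degree p \<le> n}"

text \<open>
  Matrix entries and nodes are indexed from 1. Only the values \<open>f i j (x l)\<close> at the nodes, and
  only the \<open>p i j\<close> with \<open>1 \<le> i \<le> s\<close> and \<open>1 \<le> j \<le> t\<close>, are relevant.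
\<close>

definition feasible ::
  "nat \<Rightarrow> nat \<Rightarrow> nat \<Rightarrow> (nat \<Rightarrow> nat \<Rightarrow> nat) \<Rightarrow> nat \<Rightarrow> (nat \<Rightarrow> complex) \<Rightarrow> (nat \<Rightarrow> nat \<Rightarrow> complex \<Rightarrow> complex)
    \<Rightarrow> real \<Rightarrow> (nat \<Rightarrow> nat \<Rightarrow> complex poly) \<Rightarrow> complex poly \<Rightarrow> bool" where
  "feasible s t m n d x f \<eta> p q \<longleftrightarrow>
     (\<forall>i\<in>{1..s}. \<forall>j\<in>{1..t}. p i j \<in> polys_upto (n i j)) \<and> q \<in> polys_upto d \<and> q \<noteq> 0 \<and>
     (\<forall>l\<in>{1..m}.
        (\<Sum>i=1..s. \<Sum>j=1..t. (cmod (f i j (x l) * poly q (x l) - poly (p i j) (x l)))\<^sup>2)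
          \<le> \<eta> * (cmod (poly q (x l)))\<^sup>2)"

definition eta2 ::
  "nat \<Rightarrow> nat \<Rightarrow> nat \<Rightarrow> (nat \<Rightarrow> nat \<Rightarrow> nat) \<Rightarrow> nat \<Rightarrow> (nat \<Rightarrow> complex) \<Rightarrow> (nat \<Rightarrow> nat \<Rightarrow> complex \<Rightarrow> complex)
    \<Rightarrow> real" where
  "eta2 s t m n d x f = Inf {\<eta>. \<exists>p q. feasible s t m n d x f \<eta> p q}"

text \<open>
  The infimum of a set of reals is only meaningful if the set is nonempty and bounded below; the
  next two lemmas establish this for \<open>eta2\<close>.
\<close>

lemma feasible_nonempty: "{\<eta>. \<exists>p q. feasible s t m n d x f \<eta> p q} \<noteq> {}"
proof -
  define g where "g l = (\<Sum>i=1..s. \<Sum>j=1..t. (cmod (f i j (x l)))\<^sup>2)" for l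
  have "g l \<le> sum g {1..m}" if "l \<in> {1..m}" for l
    by (rule member_le_sum) (use that in \<open>auto simp: g_def intro!: sum_nonneg\<close>)
  then have "feasible s t m n d x f (sum g {1..m}) (\<lambda>_ _. 0) 1"
    by (auto simp: feasible_def polys_upto_def g_def)
  then show ?thesis by blast
qed

lemma feasible_bdd_below:
  assumes "inj_on x {1..m}" "d < m"
  shows "bdd_below {\<eta>. \<exists>p q. feasible s t m n d x f \<eta> p q}"
proof (rule bdd_belowI[where m = 0], clarify)
  fix \<eta> p q assume F: "feasible s t m n d x f \<eta> p q"
  then have q: "q \<noteq> 0" "degree q \<le> d" by (auto simp: feasible_def polys_upto_def)
  obtain l where l: "l \<in> {1..m}" "poly q (x l) \<noteq> 0"
  proof (rule ccontr)
    assume "\<not> thesis"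
    then have "x ` {1..m} \<subseteq> {z. poly q z = 0}" using that by (fastforce simp: image_subset_iff)
    then have "card (x ` {1..m}) \<le> card {z. poly q z = 0}"
      by (intro card_mono poly_roots_finite q)
    moreover have "card {z. poly q z = 0} \<le> degree q" by (rule card_poly_roots_bound[OF q(1)])
    ultimately show False using assms q by (simp add: card_image)
  qed
  have "0 \<le> (\<Sum>i=1..s. \<Sum>j=1..t. (cmod (f i j (x l) * poly q (x l) - poly (p i j) (x l)))\<^sup>2)"
    by (intro sum_nonneg) auto
  also have "\<dots> \<le> \<eta> * (cmod (poly q (x l)))\<^sup>2"
    using F l(1) unfolding feasible_def by blast
  finally show "0 \<le> \<eta>" using l(2) by (simp add: zero_le_mult_iff)
qed

end

theory Submission
  imports Defs
begin

text \<open>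
  Constraints are invariant under a common scaling of \<open>q\<close> and the \<open>p i j\<close>, so along a minimizing
  sequence one may normalize \<open>q\<close> by \<open>(\<Sum>l=1..m. \<bar>q (x l)\<bar>) = 1\<close>. The constraints then bound the
  \<open>p i j\<close> at the nodes, and since there are more nodes than the degree of each polynomial, boundedness
  at the nodes gives a convergent subsequence. The constraints are closed conditions and the
  normalization keeps the limit of the \<open>q\<close> nonzero.
\<close>

text \<open>Bolzano-Weierstrass is applied to one sequence at a time, each time thinning the
  subsequence already found. Further thinning preserves the convergence obtained so far, and
  finitely many rounds suffice.\<close>

lemma finite_family_convergent_subseq:
  fixes u :: "'a \<Rightarrow> nat \<Rightarrow> 'b::heine_borel"
  assumes "finite A" "\<And>a. a \<in> A \<Longrightarrow> bounded (range (u a))"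
  shows "\<exists>r. strict_mono (r :: nat \<Rightarrow> nat) \<and> (\<forall>a\<in>A. convergent (u a \<circ> r))"
  using assms
proof (induction A rule: finite_induct)
  case empty
  show ?case using strict_mono_id by auto
next
  case (insert a A)
  then obtain r :: "nat \<Rightarrow> nat" where r: "strict_mono r" "\<forall>b\<in>A. convergent (u b \<circ> r)"
    by blast
  have "bounded (range (u a \<circ> r))"
    by (rule bounded_subset[OF insert.prems[of a]]) auto
  then obtain l r' where r': "strict_mono r'" "((u a \<circ> r) \<circ> r') \<longlonglongrightarrow> l"
    using bounded_imp_convergent_subsequence by blast
  have "convergent (u b \<circ> (r \<circ> r'))" if "b \<in> insert a A" for b
  proof (cases "b = a")
    case True
    then show ?thesis using r' by (auto simp: convergent_def comp_assoc)
  next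
    case False
    then have "convergent (u b \<circ> r)" using that r by auto
    then show ?thesis using convergent_subseq_convergent[OF _ r'(1)] by (metis comp_assoc)
  qed
  then show ?case using strict_mono_o[OF r(1) r'(1)] by blast
qed

text \<open>By Lagrange interpolation at \<open>n + 1\<close> points of \<open>B\<close>, the values
  of \<open>P k\<close> there are its coordinates in a basis independent of \<open>k\<close>.
  Convergence of these finitely many coordinates gives convergence at every \<open>z\<close>, to a
  combination of the same basis.\<close>

lemma poly_seq_limit:
  fixes P :: "nat \<Rightarrow> 'a::real_normed_field poly"
  assumes "n < card B"
    and deg: "\<And>k. degree (P k) \<le> n"
    and conv: "\<And>b. b \<in> B \<Longrightarrow> convergent (\<lambda>k. poly (P k) b)"
  shows "\<exists>p. degree p \<le> n \<and> (\<forall>z. (\<lambda>k. poly (P k) z) \<longlonglongrightarrow> poly p z)"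
proof -
  obtain C where C: "C \<subseteq> B" "card C = Suc n" "finite C"
    using assms(1) by (meson Suc_leI obtain_subset_with_card_n)
  \<comment> \<open>The Lagrange basis polynomials of \<open>C\<close>; each has \<open>n\<close>
    linear factors because \<open>C\<close> has \<open>n + 1\<close> points.\<close>
  define L where "L c = (\<Prod>a\<in>C - {c}. smult (inverse (c - a)) [:- a, 1:])" for c
  have degL: "degree (L c) \<le> n" if "c \<in> C" for c
  proof -
    have "degree (L c) \<le> (\<Sum>a\<in>C - {c}. degree (smult (inverse (c - a)) [:- a, 1:]))"
      unfolding L_def using C by (intro degree_prod_sum_le[unfolded comp_def]) auto
    also have "\<dots> \<le> (\<Sum>a\<in>C - {c}. 1)"
      by (intro sum_mono) simp
    finally show ?thesis using C that by simp
  qed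
  have poly_L: "poly (L c) z = (\<Prod>a\<in>C - {c}. (z - a) / (c - a))" for c z
    by (simp add: L_def poly_prod divide_inverse algebra_simps)
  have L: "poly (L c) a = (if a = c then 1 else 0)" if "a \<in> C" "c \<in> C" for a c
    using that C by (auto simp: poly_L intro!: prod.neutral)
  define v where "v c = lim (\<lambda>k. poly (P k) c)" for c
  have v: "(\<lambda>k. poly (P k) c) \<longlonglongrightarrow> v c" if "c \<in> C" for c
    using conv that C by (auto simp: v_def convergent_LIMSEQ_iff)
  have deg_interp: "degree (\<Sum>c\<in>C. smult (w c) (L c)) \<le> n" for w
    by (intro degree_sum_le C) (auto intro: degL order_trans[OF degree_smult_le])
  \<comment> \<open>Both sides have degree at most \<open>n\<close> and agree at the
    \<open>n + 1\<close> points of \<open>C\<close>.\<close>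
  have interp: "P k = (\<Sum>c\<in>C. smult (poly (P k) c) (L c))" (is "_ = ?I") for k
  proof (rule poly_eqI_degree[of C])
    show "poly (P k) a = poly ?I a" if "a \<in> C" for a
      using that C by (simp add: poly_sum L sum.delta' if_distrib cong: if_cong)
  qed (use C deg[of k] deg_interp in \<open>auto simp: less_Suc_eq_le\<close>)
  have "(\<lambda>k. poly (P k) z) \<longlonglongrightarrow> poly (\<Sum>c\<in>C. smult (v c) (L c)) z" for z
    by (subst interp) (auto simp: poly_sum intro!: tendsto_intros v)
  then show ?thesis using deg_interp by blast
qed

text \<open>Extracting over the pairs in \<open>C \<times> B\<close> makes one subsequence serve all
  members and all points; \<open>poly_seq_limit\<close> then turns convergence on \<open>B\<close>
  into a limit polynomial for each member.\<close>

lemma poly_family_convergent_subseq: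
  fixes R :: "nat \<Rightarrow> 'c \<Rightarrow> 'a::{real_normed_field,heine_borel} poly"
  assumes "finite C" "finite B"
    and card: "\<And>c. c \<in> C \<Longrightarrow> N c < card B"
    and deg: "\<And>c k. c \<in> C \<Longrightarrow> degree (R k c) \<le> N c"
    and bdd: "\<And>c b. \<lbrakk>c \<in> C; b \<in> B\<rbrakk> \<Longrightarrow> bounded (range (\<lambda>k. poly (R k c) b))"
  shows "\<exists>r G. strict_mono r \<and>
    (\<forall>c\<in>C. degree (G c) \<le> N c \<and> (\<forall>z. (\<lambda>k. poly (R (r k) c) z) \<longlonglongrightarrow> poly (G c) z))"
proof -
  obtain r where r: "strict_mono r"
    "\<forall>a\<in>C \<times> B. convergent ((\<lambda>(c, b) k. poly (R k c) b) a \<circ> r)"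
    using finite_family_convergent_subseq[of "C \<times> B" "\<lambda>(c, b) k. poly (R k c) b"] assms
    by auto
  have "\<exists>p. degree p \<le> N c \<and> (\<forall>z. (\<lambda>k. poly (R (r k) c) z) \<longlonglongrightarrow> poly p z)" if "c \<in> C" for c
    using r(2) that by (intro poly_seq_limit[OF card deg]) (auto simp: comp_def)
  then show ?thesis using r(1) by metis
qed

lemma feasible_mono:
  assumes "feasible s t m n d x f \<eta> p q" "\<eta> \<le> \<eta>'"
  shows "feasible s t m n d x f \<eta>' p q"
  using assms unfolding feasible_def
  by (meson mult_right_mono order_trans zero_le_power2)

lemma feasible_smult:
  assumes "feasible s t m n d x f \<eta> p q" "c \<noteq> 0"
  shows "feasible s t m n d x f \<eta> (\<lambda>i j. smult c (p i j)) (smult c q)"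
proof -
  \<comment> \<open>Both sides of every constraint acquire the factor
    \<open>(cmod c)\<^sup>2\<close>, which \<open>eq\<close> and \<open>eq'\<close> isolate so that
    it can be pulled out of the double sum.\<close>
  have eq: "(cmod (a * (c * b) - c * e))\<^sup>2 = (cmod c)\<^sup>2 * (cmod (a * b - e))\<^sup>2" for a b e
  proof -
    have "a * (c * b) - c * e = c * (a * b - e)" by (simp add: algebra_simps)
    then show ?thesis by (simp add: norm_mult power_mult_distrib)
  qed
  have eq': "\<eta> * (cmod (c * b))\<^sup>2 = (cmod c)\<^sup>2 * (\<eta> * (cmod b)\<^sup>2)" for b
    by (simp add: norm_mult power_mult_distrib)
  show ?thesis
    using assms
    by (auto simp: feasible_def polys_upto_def eq eq' mult_left_mono simp flip: sum_distrib_left)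
qed

text \<open>A nonzero \<open>q\<close> of degree less than \<open>m\<close> cannot vanish at all
  \<open>m\<close> distinct nodes, so the sum of its absolute values there is positive and may be
  divided out.\<close>

lemma feasible_normalized:
  assumes "feasible s t m n d x f \<eta> p q" "inj_on x {1..m}" "d < m"
  shows "\<exists>p q. feasible s t m n d x f \<eta> p q \<and> (\<Sum>l=1..m. cmod (poly q (x l))) = 1"
proof -
  define S where "S = (\<Sum>l=1..m. cmod (poly q (x l)))"
  have "S \<noteq> 0"
  proof
    assume "S = 0"
    then have "poly q b = poly 0 b" if "b \<in> x ` {1..m}" for b
      using that by (auto simp: S_def sum_nonneg_eq_0_iff)
    then have "q = 0"
      using assms by (intro poly_eqI_degree[of "x ` {1..m}"])
        (auto simp: card_image feasible_def polys_upto_def)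
    then show False using assms by (simp add: feasible_def)
  qed
  moreover have "S \<ge> 0" by (simp add: S_def sum_nonneg)
  moreover have "(\<Sum>l=1..m. cmod (poly (smult c q) (x l))) = cmod c * S" for c
    by (simp add: S_def norm_mult sum_distrib_left)
  \<comment> \<open>Deleting \<open>poly_smult\<close> keeps the sum in the form that the preceding
    scaling identity rewrites.\<close>
  ultimately have "(\<Sum>l=1..m. cmod (poly (smult (of_real (inverse S)) q) (x l))) = 1"
    by (simp add: norm_inverse del: poly_smult)
  then show ?thesis
    using feasible_smult[OF assms(1), of "of_real (inverse S)"] \<open>S \<noteq> 0\<close>
    by (metis inverse_nonzero_iff_nonzero of_real_eq_0_iff)
qed

text \<open>One squared error is at most the whole double sum, and the triangle inequality turns
  this into a bound on the entry. The bound is in terms of \<open>K\<close> rather than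
  \<open>\<eta>\<close> so that it is uniform along a sequence of levels.\<close>

lemma feasible_entry_bound:
  assumes "feasible s t m n d x f \<eta> p q" "i \<in> {1..s}" "j \<in> {1..t}" "l \<in> {1..m}"
    and "cmod (poly q (x l)) \<le> 1" "\<eta> \<le> K"
  shows "cmod (poly (p i j) (x l)) \<le> cmod (f i j (x l)) + sqrt \<bar>K\<bar>"
proof -
  let ?e = "\<lambda>i j. (cmod (f i j (x l) * poly q (x l) - poly (p i j) (x l)))\<^sup>2"
  have "?e i j \<le> (\<Sum>j=1..t. ?e i j)"
    by (rule member_le_sum) (use assms in auto)
  also have "\<dots> \<le> (\<Sum>i=1..s. \<Sum>j=1..t. ?e i j)"
    by (rule member_le_sum[where f = "\<lambda>i. \<Sum>j=1..t. ?e i j"]) (use assms in \<open>auto intro!: sum_nonneg\<close>)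
  also have "\<dots> \<le> \<eta> * (cmod (poly q (x l)))\<^sup>2"
    using assms by (auto simp: feasible_def)
  \<comment> \<open>The absolute value supplies the nonnegative factor required for multiplying the
    two inequalities.\<close>
  also have "\<dots> \<le> \<bar>K\<bar> * 1"
    using assms by (intro mult_mono) (auto simp: power_le_one)
  finally have "cmod (f i j (x l) * poly q (x l) - poly (p i j) (x l)) \<le> sqrt \<bar>K\<bar>"
    by (simp add: real_le_rsqrt)
  moreover have "cmod (f i j (x l) * poly q (x l)) \<le> cmod (f i j (x l))"
    using assms by (simp add: norm_mult mult_left_le)
  ultimately show ?thesis
    by (smt (verit) norm_triangle_ineq2 norm_minus_commute)
qed

theorem theorem2p1:
  fixes s t m d :: nat
    and n :: "nat \<Rightarrow> nat \<Rightarrow> nat"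
    and x :: "nat \<Rightarrow> complex"
    and f :: "nat \<Rightarrow> nat \<Rightarrow> complex \<Rightarrow> complex"
  assumes "s \<ge> 1" and "t \<ge> 1"
    and "m \<ge> (MAX (i, j)\<in>{1..s} \<times> {1..t}. n i j + d + 2)"
    and "inj_on x {1..m}"
  shows "\<exists>p q. feasible s t m n d x f (eta2 s t m n d x f) p q"
proof -
  define e where "e = eta2 s t m n d x f"
  have m: "n i j + d + 2 \<le> m" if "i \<in> {1..s}" "j \<in> {1..t}" for i j
    using assms(3) that by (subst (asm) Max_le_iff) auto
  \<comment> \<open>Since \<open>s\<close> and \<open>t\<close> are positive, the index pair
    \<open>(1, 1)\<close> exists and yields a bound on \<open>d\<close> alone.\<close>
  have "n 1 1 + d + 2 \<le> m" using assms by (intro m) auto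
  then have "d < m" by simp
  \<comment> \<open>The minimizing sequence: some feasible level lies below the infimum plus
    \<open>inverse (real (Suc k))\<close>, and feasibility passes up to that larger level.\<close>
  have "\<exists>p q. feasible s t m n d x f (e + inverse (real (Suc k))) p q
      \<and> (\<Sum>l=1..m. cmod (poly q (x l))) = 1" for k
  proof -
    have "e < e + inverse (real (Suc k))" by simp
    then obtain \<eta> p q where "feasible s t m n d x f \<eta> p q" "\<eta> < e + inverse (real (Suc k))"
      using cInf_lessD[OF feasible_nonempty] unfolding e_def eta2_def by blast
    then show ?thesis
      using feasible_normalized assms(4) \<open>d < m\<close> feasible_mono less_imp_le by metis
  qed
  then obtain p q where
    pq: "\<And>k. feasible s t m n d x f (e + inverse (real (Suc k))) (p k) (q k)"
    and q1: "\<And>k. (\<Sum>l=1..m. cmod (poly (q k) (x l))) = 1"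
    by metis
  have q_le: "cmod (poly (q k) (x l)) \<le> 1" if "l \<in> {1..m}" for k l
    unfolding q1[of k, symmetric] by (rule member_le_sum) (use that in auto)
  \<comment> \<open>All levels \<open>e + inverse (real (Suc k))\<close> are at most
    \<open>e + 1\<close>, so this bound does not depend on \<open>k\<close>.\<close>
  have p_le: "cmod (poly (p k i j) (x l)) \<le> cmod (f i j (x l)) + sqrt \<bar>e + 1\<bar>"
    if "i \<in> {1..s}" "j \<in> {1..t}" "l \<in> {1..m}" for k i j l
    using that q_le by (intro feasible_entry_bound[OF pq[of k]]) (auto simp: field_simps)
  \<comment> \<open>The denominator (\<open>None\<close>) and the numerators
    (\<open>Some (i, j)\<close>) form a single finite family, so that a common subsequence is
    extracted for all of them.\<close>
  define R where "R k c = (case c of None \<Rightarrow> q k | Some (i, j) \<Rightarrow> p k i j)" for k c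
  define N where "N c = (case c of None \<Rightarrow> d | Some (i, j) \<Rightarrow> n i j)" for c
  define C where "C = insert None (Some ` ({1..s} \<times> {1..t}))"
  have "\<exists>r G. strict_mono r \<and>
    (\<forall>c\<in>C. degree (G c) \<le> N c \<and> (\<forall>z. (\<lambda>k. poly (R (r k) c) z) \<longlonglongrightarrow> poly (G c) z))"
  proof (rule poly_family_convergent_subseq[where B = "x ` {1..m}"])
    show "N c < card (x ` {1..m})" if "c \<in> C" for c
      using that m \<open>d < m\<close> assms(4) by (fastforce simp: C_def N_def card_image)
    show "degree (R k c) \<le> N c" if "c \<in> C" for c k
      using that pq[of k] by (auto simp: C_def N_def R_def feasible_def polys_upto_def)
    show "bounded (range (\<lambda>k. poly (R k c) b))" if "c \<in> C" "b \<in> x ` {1..m}" for c b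
      using that q_le p_le by (auto simp: C_def R_def bounded_iff split: option.splits; blast)
  qed (auto simp: C_def)
  then obtain r G where r: "strict_mono r"
    and deg: "\<And>c. c \<in> C \<Longrightarrow> degree (G c) \<le> N c"
    and lim: "\<And>c z. c \<in> C \<Longrightarrow> (\<lambda>k. poly (R (r k) c) z) \<longlonglongrightarrow> poly (G c) z"
    by blast
  define P Q where "P i j = G (Some (i, j))" and "Q = G None" for i j
  have limQ: "(\<lambda>k. poly (q (r k)) z) \<longlonglongrightarrow> poly Q z" for z
    using lim[of None z] by (simp add: C_def R_def Q_def)
  have limP: "(\<lambda>k. poly (p (r k) i j) z) \<longlonglongrightarrow> poly (P i j) z"
    if "i \<in> {1..s}" "j \<in> {1..t}" for i j z
    using lim[of "Some (i, j)" z] that by (simp add: C_def R_def P_def)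
  \<comment> \<open>The normalization survives the limit, which rules out
    \<open>Q = 0\<close>.\<close>
  have "(\<lambda>k. \<Sum>l=1..m. cmod (poly (q (r k)) (x l))) \<longlonglongrightarrow> (\<Sum>l=1..m. cmod (poly Q (x l)))"
    by (intro tendsto_intros limQ)
  then have "(\<Sum>l=1..m. cmod (poly Q (x l))) = 1"
    unfolding q1 LIMSEQ_const_iff by (rule sym)
  then have "Q \<noteq> 0" by auto
  moreover have "(\<Sum>i=1..s. \<Sum>j=1..t. (cmod (f i j (x l) * poly Q (x l) - poly (P i j) (x l)))\<^sup>2)
      \<le> e * (cmod (poly Q (x l)))\<^sup>2" if "l \<in> {1..m}" for l
  \<comment> \<open>Each constraint is a non-strict inequality between continuous expressions in the
    values at \<open>x l\<close>, and the slack in the level tends to 0 along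
    \<open>r\<close>.\<close>
  proof (rule LIMSEQ_le)
    show "(\<lambda>k. \<Sum>i=1..s. \<Sum>j=1..t.
        (cmod (f i j (x l) * poly (q (r k)) (x l) - poly (p (r k) i j) (x l)))\<^sup>2)
      \<longlonglongrightarrow> (\<Sum>i=1..s. \<Sum>j=1..t. (cmod (f i j (x l) * poly Q (x l) - poly (P i j) (x l)))\<^sup>2)"
      by (intro tendsto_intros limQ limP)
    have "(\<lambda>k. inverse (real (Suc (r k)))) \<longlonglongrightarrow> 0"
      using LIMSEQ_subseq_LIMSEQ[OF LIMSEQ_inverse_real_of_nat r] by (simp add: comp_def)
    then have "(\<lambda>k. (e + inverse (real (Suc (r k)))) * (cmod (poly (q (r k)) (x l)))\<^sup>2)
      \<longlonglongrightarrow> (e + 0) * (cmod (poly Q (x l)))\<^sup>2"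
      by (intro tendsto_intros limQ)
    then show "(\<lambda>k. (e + inverse (real (Suc (r k)))) * (cmod (poly (q (r k)) (x l)))\<^sup>2)
      \<longlonglongrightarrow> e * (cmod (poly Q (x l)))\<^sup>2"
      by simp
    show "\<exists>K. \<forall>k\<ge>K. (\<Sum>i=1..s. \<Sum>j=1..t.
        (cmod (f i j (x l) * poly (q (r k)) (x l) - poly (p (r k) i j) (x l)))\<^sup>2)
      \<le> (e + inverse (real (Suc (r k)))) * (cmod (poly (q (r k)) (x l)))\<^sup>2"
      using pq that unfolding feasible_def by blast
  qed
  moreover have "degree Q \<le> d" "\<And>i j. \<lbrakk>i \<in> {1..s}; j \<in> {1..t}\<rbrakk> \<Longrightarrow> degree (P i j) \<le> n i j"
    using deg[of None] deg[of "Some (i, j)" for i j] by (auto simp: C_def N_def P_def Q_def)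
  ultimately have "feasible s t m n d x f e P Q"
    by (simp add: feasible_def polys_upto_def)
  then show ?thesis unfolding e_def by blast
qed

end
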